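(* Let $\mathcal{A},\mathcal{B}$ be two finite alphabets, let $\zeta$ be an aperiodic primitive constant-shape substitution on $\mathbb{Z}^d$ with alphabet $\mathcal{A}$ and expansion matrix $L$, and let $\tau:\mathcal{A}\to\mathcal{B}$ be a map, extended coordinatewise to $\mathcal{A}^{\mathbb{Z}^d}\to\mathcal{B}^{\mathbb{Z}^d}$, such that $(\tau(X_\zeta),S,\mathbb{Z}^d)$ is an aperiodic subshift. Let $x\in X_\zeta$ be a fixed point of $\zeta$ (i.e. $\zeta(x)=x$) and $y=\tau(x)$. Then there exists $R>0$ such that for all $i,j\in\mathbb{Z}^d$: if $y|_{i+B(0,R)}=y|_{j+B(0,R)}$ (meaning $y_{i+m}=y_{j+m}$ for all $m\in B(0,R)\cap\mathbb{Z}^d$) and $i\in L(\mathbb{Z}^d)$, then $j\in L(\mathbb{Z}^d)$.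
   Context: Let $d\ge 1$; $\|\cdot\|$ is the Euclidean norm on $\mathbb{R}^d$ and the induced operator norm on matrices. For a finite alphabet $\mathcal{A}$, $\mathcal{A}^{\mathbb{Z}^d}$ carries the product topology and the shift action $(S^{n}x)_{k}=x_{n+k}$. A subshift is a closed shift-invariant subset; it is aperiodic if none of its points $x$ has a nonzero period (a $p\in\mathbb{Z}^d\setminus\{0\}$ with $x_{k+p}=x_k$ for all $k$). A pattern is an element of $\mathcal{A}^P$ with $P\subset\mathbb{Z}^d$ finite (identified up to translation of the support); it occurs in $x$ at $n$ if it equals $x|_{n+P}$. Constant-shape substitution: let $L$ be a $d\times d$ integer matrix with $\|L\|>1$, $\|L^{-1}\|<1$ (expansion matrix), and let $F_1\subset\mathbb{Z}^d$ be a set of representatives of $\mathbb{Z}^d/L(\mathbb{Z}^d)$ with $0\in F_1$ (support). A constant-shape substitution is a map $\zeta:\mathcal{A}\to\mathcal{A}^{F_1}$. It extends to $\mathcal{A}^{\mathbb{Z}^d}$ by $\zeta(x)_{L(j)+f}=\zeta(x_j)_f$ ($j\in\mathbb{Z}^d$, $f\in F_1$). Its iterates $\zeta^n:\mathcal{A}\to\mathcal{A}^{F_n}$ have expansion matrix $L^n$ and support $F_n$, where $F_{n+1}=F_1+L(F_n)$, and $\zeta^{n+1}(a)_{L(g)+f}=\zeta(\zeta^n(a)_g)_f$ for $g\in F_n,f\in F_1$. Standing assumption: $(F_n)_{n>0}$ is a Følner sequence, i.e. $|F_n\,\Delta\,(m+F_n)|/|F_n|\to0$ for every $m\in\mathbb{Z}^d$.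 $\zeta$ is primitive if for some $n>0$ every letter occurs in $\zeta^n(a)$ for every $a\in\mathcal{A}$. $X_\zeta$ is the subshift of all $x\in\mathcal{A}^{\mathbb{Z}^d}$ such that every pattern occurring in $x$ occurs in some $\zeta^n(a)$, $n>0$, $a\in\mathcal{A}$. $\zeta$ is aperiodic if $X_\zeta$ is. *)

theory Defs
  imports "HOL-Analysis.Analysis"
begin

text \<open>Configurations are functions on \<open>\<int>\<^sup>d\<close>, which is the type \<^typ>\<open>int ^ 'd\<close>; finite
  alphabets are types of class \<^class>\<open>finite\<close>.\<close>

type_synonym ('d, 'a) config = "int ^ 'd \<Rightarrow> 'a"

definition real_vec :: "int ^ 'd \<Rightarrow> real ^ 'd::finite" where
  "real_vec v = (\<chi> i. real_of_int (v $ i))"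

definition real_mat :: "int ^ 'd ^ 'd \<Rightarrow> real ^ 'd ^ 'd::finite" where
  "real_mat M = map_matrix real_of_int M"

subsection \<open>Subshifts\<close>

text \<open>The product topology is the abstract one, since a type of class \<^class>\<open>finite\<close> carries
  no canonical discrete topology as a type class instance.\<close>

definition config_topology :: "('d::finite, 'a) config topology" where
  "config_topology = product_topology (\<lambda>_. discrete_topology UNIV) UNIV"

definition shift :: "int ^ 'd \<Rightarrow> ('d::finite, 'a) config \<Rightarrow> ('d, 'a) config" where
  "shift n x = (\<lambda>k. x (n + k))"

definition subshift :: "('d::finite, 'a) config set \<Rightarrow> bool" where
  "subshift X \<longleftrightarrow> closedin config_topology X \<and> (\<forall>n. shift n ` X = X)"

definition aperiodic :: "('d::finite, 'a) config set \<Rightarrow> bool" where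
  "aperiodic X \<longleftrightarrow> (\<forall>x\<in>X. \<not> (\<exists>p. p \<noteq> 0 \<and> (\<forall>k. x (k + p) = x k)))"

subsection \<open>Expansion matrices and supports\<close>

text \<open>The lattice \<open>M(\<int>\<^sup>d)\<close>.\<close>

definition lattice :: "int ^ 'd ^ 'd \<Rightarrow> (int ^ 'd::finite) set" where
  "lattice M = range (\<lambda>v. M *v v)"

definition expansion_matrix :: "int ^ 'd ^ 'd::finite \<Rightarrow> bool" where
  "expansion_matrix M \<longleftrightarrow>
     invertible (real_mat M) \<and>
     onorm (\<lambda>v. real_mat M *v v) > 1 \<and>
     onorm (\<lambda>v. matrix_inv (real_mat M) *v v) < 1"

definition representatives :: "int ^ 'd ^ 'd::finite \<Rightarrow> (int ^ 'd) set \<Rightarrow> bool" where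
  "representatives M F \<longleftrightarrow> (\<forall>k. \<exists>!f. f \<in> F \<and> k - f \<in> lattice M)"

text \<open>Starting from \<open>F\<^sub>0 = {0}\<close> gives \<open>F\<^sub>1 = F\<close>, see \<open>supp_1\<close> below.\<close>

primrec supp :: "int ^ 'd ^ 'd::finite \<Rightarrow> (int ^ 'd) set \<Rightarrow> nat \<Rightarrow> (int ^ 'd) set" where
  "supp M F 0 = {0}"
| "supp M F (Suc n) = {f + M *v g | f g. f \<in> F \<and> g \<in> supp M F n}"

lemma supp_1: "supp M F 1 = F"
  by simp

definition Folner :: "(nat \<Rightarrow> (int ^ 'd::finite) set) \<Rightarrow> bool" where
  "Folner G \<longleftrightarrow>
     (\<forall>m. (\<lambda>n. real (card (sym_diff (G n) ((+) m ` G n))) / real (card (G n))) \<longlonglongrightarrow> 0)"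

definition substitution_data :: "int ^ 'd ^ 'd::finite \<Rightarrow> (int ^ 'd) set \<Rightarrow> bool" where
  "substitution_data M F \<longleftrightarrow>
     expansion_matrix M \<and> representatives M F \<and> 0 \<in> F \<and> Folner (supp M F)"

subsection \<open>Constant-shape substitutions\<close>

text \<open>The unique \<open>(j, f)\<close> with \<open>f \<in> F\<close> and \<open>k = M j + f\<close>.\<close>

definition decomp :: "int ^ 'd ^ 'd::finite \<Rightarrow> (int ^ 'd) set \<Rightarrow> int ^ 'd \<Rightarrow> (int ^ 'd) \<times> (int ^ 'd)" where
  "decomp M F k = (THE (j, f). f \<in> F \<and> k = M *v j + f)"

text \<open>A pattern with support \<open>P\<close> is represented by a total function of which only the values on
  \<open>P\<close> are used; thus \<open>\<zeta> a\<close> below stands for an element of \<open>\<A>\<^sup>F\<close>.\<close>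

definition extend :: "int ^ 'd ^ 'd::finite \<Rightarrow> (int ^ 'd) set \<Rightarrow> ('a \<Rightarrow> int ^ 'd \<Rightarrow> 'a) \<Rightarrow>
    ('d, 'a) config \<Rightarrow> ('d, 'a) config" where
  "extend M F \<zeta> x = (\<lambda>k. case decomp M F k of (j, f) \<Rightarrow> \<zeta> (x j) f)"

text \<open>\<open>iterate M F \<zeta> n a\<close> represents \<open>\<zeta>\<^sup>n(a)\<close>, a pattern with support \<open>supp M F n\<close>.\<close>

primrec iterate :: "int ^ 'd ^ 'd::finite \<Rightarrow> (int ^ 'd) set \<Rightarrow> ('a \<Rightarrow> int ^ 'd \<Rightarrow> 'a) \<Rightarrow>
    nat \<Rightarrow> 'a \<Rightarrow> int ^ 'd \<Rightarrow> 'a" where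
  "iterate M F \<zeta> 0 a = (\<lambda>_. a)"
| "iterate M F \<zeta> (Suc n) a =
     (\<lambda>k. case decomp M F k of (g, f) \<Rightarrow> \<zeta> (iterate M F \<zeta> n a g) f)"

text \<open>The pattern \<open>u\<close> with support \<open>P\<close> occurs in \<open>w\<close>, whose support is \<open>Q\<close>
  (\<open>Q = UNIV\<close> for configurations).\<close>

definition occurs :: "(int ^ 'd::finite) set \<Rightarrow> (int ^ 'd \<Rightarrow> 'a) \<Rightarrow>
    (int ^ 'd) set \<Rightarrow> (int ^ 'd \<Rightarrow> 'a) \<Rightarrow> bool" where
  "occurs P u Q w \<longleftrightarrow> (\<exists>n. \<forall>k\<in>P. n + k \<in> Q \<and> w (n + k) = u k)"

definition primitive :: "int ^ 'd ^ 'd::finite \<Rightarrow> (int ^ 'd) set \<Rightarrow> ('a \<Rightarrow> int ^ 'd \<Rightarrow> 'a) \<Rightarrow> bool" where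
  "primitive M F \<zeta> \<longleftrightarrow> (\<exists>n>0. \<forall>a b. \<exists>k\<in>supp M F n. iterate M F \<zeta> n a k = b)"

definition subst_shift :: "int ^ 'd ^ 'd::finite \<Rightarrow> (int ^ 'd) set \<Rightarrow> ('a \<Rightarrow> int ^ 'd \<Rightarrow> 'a) \<Rightarrow>
    ('d, 'a) config set" where
  "subst_shift M F \<zeta> =
     {x. \<forall>P u. finite P \<longrightarrow> occurs P u UNIV x \<longrightarrow>
        (\<exists>n>0. \<exists>a. occurs P u (supp M F n) (iterate M F \<zeta> n a))}"

subsection \<open>The defining equations of extension and iteration\<close>

lemma real_vec_mult: "real_vec (M *v v) = real_mat M *v real_vec v"
  by (simp add: real_vec_def real_mat_def matrix_vector_mult_def vec_eq_iff)

lemma inj_mult: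
  assumes "expansion_matrix M" "M *v v = M *v w"
  shows "v = w"
proof -
  have "real_mat M *v real_vec v = real_mat M *v real_vec w"
    using assms(2) by (metis real_vec_mult)
  moreover have "inj ((*v) (real_mat M))"
    using assms(1) unfolding expansion_matrix_def by (simp add: inj_matrix_vector_mult)
  ultimately have "real_vec v = real_vec w"
    by (simp add: inj_eq)
  then show ?thesis
    by (simp add: real_vec_def vec_eq_iff)
qed

lemma decomp_eq:
  assumes "expansion_matrix M" "representatives M F" "f \<in> F"
  shows "decomp M F (M *v j + f) = (j, f)"
proof -
  have "g = f \<and> i = j" if "g \<in> F" "M *v j + f = M *v i + g" for i g
  proof -
    have "M *v j + f - f \<in> lattice M"
      by (simp add: lattice_def)
    moreover have "M *v j + f - g \<in> lattice M"
      unfolding that(2) by (simp add: lattice_def)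
    ultimately have "g = f"
      using assms(2,3) that(1) unfolding representatives_def by blast
    then show ?thesis
      using that(2) inj_mult[OF assms(1)] by auto
  qed
  then show ?thesis
    unfolding decomp_def by (intro the_equality) (use assms(3) in auto)
qed

lemma extend_eq:
  assumes "expansion_matrix M" "representatives M F" "f \<in> F"
  shows "extend M F \<zeta> x (M *v j + f) = \<zeta> (x j) f"
  using decomp_eq[OF assms] by (simp add: extend_def)

lemma iterate_Suc_eq:
  assumes "expansion_matrix M" "representatives M F" "f \<in> F"
  shows "iterate M F \<zeta> (Suc n) a (M *v g + f) = \<zeta> (iterate M F \<zeta> n a g) f"
  using decomp_eq[OF assms] by simp

lemma iterate_1_eq:
  assumes "expansion_matrix M" "representatives M F" "f \<in> F"
  shows "iterate M F \<zeta> 1 a f = \<zeta> a f"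
  using iterate_Suc_eq[OF assms, of \<zeta> 0 a 0] by simp

end

theory Submission
  imports Defs
begin

text \<open>
  Let \<open>H\<^sub>n\<close> (\<open>returns n\<close>) be the set of the \<open>g\<close> such that every central pattern of \<open>y\<close> recurs at a position in
  \<open>g + L\<^sup>n(\<int>\<^sup>d)\<close>. It is closed under addition, and \<open>H\<^sub>n / L\<^sup>n(\<int>\<^sup>d)\<close> has a size bounded independently
  of \<open>n\<close>: two return classes for which the same pattern of \<open>x\<close> of fixed size (inflated \<open>n\<close> times)
  covers the return would give a large block of \<open>y\<close> with a comparatively small local period. By
  minimality this local period spreads to a period of \<open>y\<close>, which does not exist. As
  \<open>H\<^bsub>n+1\<^esub>\<close> maps onto \<open>H\<^sub>n / L\<^sup>n(\<int>\<^sup>d)\<close>, the inverse limit is a finite subgroup of the odometer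
  \<open>lim \<int>\<^sup>d / L\<^sup>n(\<int>\<^sup>d)\<close>. The odometer is torsion-free, so \<open>H\<^sub>1 = L(\<int>\<^sup>d)\<close>. Since \<open>x\<close> is a fixed
  point, every central pattern of \<open>y\<close> recurs in \<open>L(\<int>\<^sup>d)\<close> with bounded gaps, which turns this into
  recognizability with a uniform radius.
\<close>

section \<open>Bounded integer vectors and finiteness of digit sets\<close>

lemma finite_bounded_int_vecs: "finite {v :: int ^ 'd::finite. norm (real_vec v) \<le> K}"
proof (rule finite_subset)
  let ?B = "{- \<lceil>K\<rceil>..\<lceil>K\<rceil>}"
  show "{v :: int ^ 'd. norm (real_vec v) \<le> K} \<subseteq> vec_lambda ` (\<Pi>\<^sub>E i\<in>UNIV. ?B)"
  proof
    fix v :: "int ^ 'd" assume v: "v \<in> {v. norm (real_vec v) \<le> K}"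
    have "v $ i \<in> ?B" for i
    proof -
      have "\<bar>real_of_int (v $ i)\<bar> \<le> K"
        using component_le_norm_cart[of "real_vec v" i] v by (simp add: real_vec_def)
      then show ?thesis by (simp add: abs_le_iff) linarith
    qed
    then show "v \<in> vec_lambda ` (\<Pi>\<^sub>E i\<in>UNIV. ?B)"
      by (intro image_eqI[of _ _ "\<lambda>i. v $ i"]) auto
  qed
  show "finite (vec_lambda ` (\<Pi>\<^sub>E i\<in>(UNIV :: 'd set). ?B))"
    by (intro finite_imageI finite_PiE) auto
qed

lemma real_vec_add: "real_vec (v + w) = real_vec v + real_vec w"
  and real_vec_diff: "real_vec (v - w) = real_vec v - real_vec w"
  by (simp_all add: real_vec_def vec_eq_iff)

lemma real_vec_0: "real_vec 0 = 0"
  by (simp add: real_vec_def vec_eq_iff)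

lemma matrix_inv_mult_vec:
  assumes "invertible A"
  shows "A *v (matrix_inv A *v v) = v" "matrix_inv A *v (A *v v) = v"
  using someI_ex[OF assms[unfolded invertible_def]]
  by (simp_all add: matrix_inv_def matrix_vector_mul_assoc)

text \<open>Rounding down the coordinates of L^-1 f and subtracting the resulting lattice point
  leaves a bounded k congruent to f. As f is the only representative of the class of k, F is an
  image of a finite set of bounded vectors.\<close>

lemma finite_representatives:
  fixes L :: "int ^ 'd ^ 'd::finite"
  assumes "expansion_matrix L" "representatives L F"
  shows "finite F"
proof -
  let ?A = "real_mat L"
  obtain K where K: "\<And>v. norm (?A *v v) \<le> norm v * K"
    using bounded_linear.bounded[OF matrix_vector_mul_bounded_linear[of ?A]] by blast
  obtain B where B: "\<And>v :: real ^ 'd. (\<And>i. norm (v $ i) \<le> 1) \<Longrightarrow> norm v \<le> B"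
  proof
    show "norm v \<le> norm ((\<chi> i. 1) :: real ^ 'd)" if "\<And>i. norm (v $ i) \<le> 1" for v :: "real ^ 'd"
      by (rule norm_le_componentwise_cart) (use that in simp)
  qed
  let ?S = "{v. norm (real_vec v) \<le> B * \<bar>K\<bar>}"
  have inv: "?A *v (matrix_inv ?A *v v) = v" for v
    using assms(1) unfolding expansion_matrix_def by (simp add: matrix_inv_mult_vec)
  have "f \<in> (\<lambda>k. THE f. f \<in> F \<and> k - f \<in> lattice L) ` ?S" if f: "f \<in> F" for f
  proof -
    define u where "u = matrix_inv ?A *v real_vec f"
    define j :: "int ^ 'd" where "j = (\<chi> i. \<lfloor>u $ i\<rfloor>)"
    define k where "k = f - L *v j"
    have "real_vec k = ?A *v (u - real_vec j)"
      unfolding k_def by (simp add: real_vec_diff real_vec_mult u_def matrix_vector_mult_diff_distrib inv)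
    moreover have "norm (u - real_vec j) \<le> B"
    proof (rule B)
      show "norm ((u - real_vec j) $ i) \<le> 1" for i
        using of_int_floor_le[of "u $ i"] real_of_int_floor_add_one_gt[of "u $ i"]
        unfolding vector_minus_component j_def real_vec_def vec_lambda_beta real_norm_def by arith
    qed
    moreover have "norm (u - real_vec j) * K \<le> norm (u - real_vec j) * \<bar>K\<bar>"
      by (intro mult_left_mono) auto
    ultimately have k: "norm (real_vec k) \<le> B * \<bar>K\<bar>"
      using K[of "u - real_vec j"] mult_right_mono[of "norm (u - real_vec j)" B "\<bar>K\<bar>"]
      by (simp only:) (meson abs_ge_zero order_trans)
    have "k - f = L *v (- j)"
      by (simp add: k_def matrix_vector_mult_def vec_eq_iff sum_negf)
    then have "k - f \<in> lattice L"
      unfolding lattice_def by blast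
    then have "(THE f. f \<in> F \<and> k - f \<in> lattice L) = f"
      using the1_equality[OF assms(2)[unfolded representatives_def, rule_format]] f by blast
    with k show ?thesis by (intro image_eqI[of _ _ k]) simp_all
  qed
  then show ?thesis
    by (intro finite_surj[OF finite_bounded_int_vecs] subsetI)
qed

section \<open>Digit expansions and recurrence in the fixed point\<close>

locale substitution_fixed_point =
  fixes L :: "int ^ 'd ^ 'd::finite"
    and F :: "(int ^ 'd) set"
    and \<zeta> :: "'a::finite \<Rightarrow> int ^ 'd \<Rightarrow> 'a"
    and x :: "('d, 'a) config"
  assumes expansion: "expansion_matrix L"
    and repr: "representatives L F"
    and prim: "primitive L F \<zeta>"
    and x_in: "x \<in> subst_shift L F \<zeta>"
    and fixed: "extend L F \<zeta> x = x"
begin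

abbreviation E :: "nat \<Rightarrow> int ^ 'd \<Rightarrow> int ^ 'd" where
  "E n \<equiv> ((*v) L) ^^ n"

abbreviation \<Lambda> :: "nat \<Rightarrow> (int ^ 'd) set" where
  "\<Lambda> n \<equiv> range (E n)"

lemma E_add: "E n (v + w) = E n v + E n w"
  by (induction n) (simp_all add: matrix_vector_right_distrib)

lemma E_diff: "E n (v - w) = E n v - E n w"
  using E_add[of n "v - w" w] by (simp add: algebra_simps)

lemma E_scale: "E n (c *s v) = c *s E n v"
  by (induction n) (simp_all add: matrix_vector_mult_def vec_eq_iff sum_distrib_left mult_ac)

lemma inj_E: "E n v = E n w \<Longrightarrow> v = w"
  by (induction n) (use inj_mult[OF expansion] in auto)

lemma \<Lambda>_Suc: "k \<in> \<Lambda> (Suc n) \<Longrightarrow> k \<in> \<Lambda> n"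
  by (auto simp: funpow_swap1)

lemma \<Lambda>_add: "v \<in> \<Lambda> n \<Longrightarrow> w \<in> \<Lambda> n \<Longrightarrow> v + w \<in> \<Lambda> n"
  by (auto simp flip: E_add)

lemma \<Lambda>_diff: "v \<in> \<Lambda> n \<Longrightarrow> w \<in> \<Lambda> n \<Longrightarrow> v - w \<in> \<Lambda> n"
  by (auto simp flip: E_diff)

lemma \<Lambda>_scale: "v \<in> \<Lambda> n \<Longrightarrow> c *s v \<in> \<Lambda> n"
  by (auto simp flip: E_scale)

lemma F_split: obtains j f where "f \<in> F" "k = L *v j + f"
proof -
  obtain f where "f \<in> F" "k - f \<in> lattice L"
    using repr unfolding representatives_def by blast
  then obtain j where "k - f = L *v j" by (auto simp: lattice_def)
  with \<open>f \<in> F\<close> show ?thesis by (intro that[of f j]) (auto simp: algebra_simps)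
qed

lemma finite_F: "finite F"
  by (rule finite_representatives[OF expansion repr])

lemma finite_supp: "finite (supp L F n)"
proof (induction n)
  case (Suc n)
  have "supp L F (Suc n) = (\<lambda>(f, g). f + L *v g) ` (F \<times> supp L F n)" by auto
  with Suc finite_F show ?case by simp
qed simp

lemma supp_split: "\<exists>j. \<exists>h\<in>supp L F n. k = E n j + h"
proof (induction n arbitrary: k)
  case (Suc n)
  obtain j f where f: "f \<in> F" "k = L *v j + f" by (rule F_split)
  obtain i h where "h \<in> supp L F n" "j = E n i + h" using Suc by blast
  with f show ?case
    by (intro exI[of _ i] bexI[of _ "f + L *v h"]) (auto simp: matrix_vector_right_distrib)
qed simp

text \<open>The recursion of \<open>supp\<close> adds a new least significant digit. Moving the new
  digit to the top, with weight L^n, is what an induction that passes carries upwards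
  requires.\<close>

lemma supp_Suc_outer:
  "k \<in> supp L F (Suc n) \<longleftrightarrow> (\<exists>h\<in>supp L F n. \<exists>f\<in>F. k = h + E n f)"
proof (induction n arbitrary: k)
  case (Suc n)
  have "k \<in> supp L F (Suc (Suc n)) \<longleftrightarrow> (\<exists>f\<in>F. \<exists>g\<in>supp L F (Suc n). k = f + L *v g)"
    by auto
  also have "\<dots> \<longleftrightarrow> (\<exists>f\<in>F. \<exists>h\<in>supp L F n. \<exists>f'\<in>F. k = f + L *v (h + E n f'))"
    unfolding Bex_def Suc by blast
  also have "\<dots> \<longleftrightarrow> (\<exists>f\<in>F. \<exists>h\<in>supp L F n. \<exists>f'\<in>F. k = (f + L *v h) + E (Suc n) f')"
    by (simp add: matrix_vector_right_distrib add.assoc)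
  also have "\<dots> \<longleftrightarrow> (\<exists>h\<in>supp L F (Suc n). \<exists>f\<in>F. k = h + E (Suc n) f)"
    unfolding supp.simps by blast
  finally show ?case .
qed simp

lemma fixed_iterate:
  "h \<in> supp L F n \<Longrightarrow> x (E n j + h) = iterate L F \<zeta> n (x j) h"
proof (induction n arbitrary: h)
  case (Suc n)
  then obtain f g where fg: "f \<in> F" "g \<in> supp L F n" "h = L *v g + f"
    by (auto simp: add.commute)
  have "x (E (Suc n) j + h) = extend L F \<zeta> x (L *v (E n j + g) + f)"
    by (simp add: fixed fg matrix_vector_right_distrib add.assoc)
  also have "\<dots> = \<zeta> (x (E n j + g)) f"
    by (rule extend_eq[OF expansion repr fg(1)])
  also have "\<dots> = iterate L F \<zeta> (Suc n) (x j) h"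
    by (simp only: fg(3) Suc.IH[OF fg(2)] iterate_Suc_eq[OF expansion repr fg(1)])
  finally show ?case .
qed simp

text \<open>The \<open>b\<close> are the carries in an addition with digits in \<open>F\<close>; they stay in a fixed ball because
  \<open>L\<^sup>-\<^sup>1\<close> is a contraction.\<close>

lemma bounded_carries:
  obtains C where "finite C" "0 \<in> C"
    "\<And>n f g h. f \<in> supp L F n \<Longrightarrow> g \<in> supp L F n \<Longrightarrow> h \<in> supp L F n \<Longrightarrow>
      \<exists>b\<in>C. \<exists>k\<in>supp L F n. f + g - h = E n b + k"
proof -
  let ?I = "matrix_inv (real_mat L)"
  define c where "c = onorm ((*v) ?I)"
  have c: "c < 1" "0 \<le> c"
    using expansion onorm_pos_le[OF matrix_vector_mul_bounded_linear[of ?I]]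
    unfolding expansion_matrix_def c_def by simp_all
  obtain r where r: "0 \<le> r" "\<And>f. f \<in> F \<Longrightarrow> norm (real_vec f) \<le> r"
  proof
    show "0 \<le> (\<Sum>f\<in>F. norm (real_vec f))" by (simp add: sum_nonneg)
    show "norm (real_vec f) \<le> (\<Sum>f\<in>F. norm (real_vec f))" if "f \<in> F" for f
      by (rule member_le_sum[OF that _ finite_F]) simp
  qed
  \<comment> \<open>Fixed point of K = c (K + 4 r): a new carry is L^-1 applied to the old carry
    combined with four digits, three from the operands and one from the result.\<close>
  define K where "K = 4 * r * c / (1 - c)"
  have K: "0 \<le> K" "c * (K + 4 * r) = K"
    using c r(1) by (auto simp: K_def field_simps)
  have step: "norm (real_vec b') \<le> K"
    if b: "norm (real_vec b) \<le> K" and F: "f \<in> F" "g \<in> F" "h \<in> F" "k \<in> F"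
      and eq: "b + f + g - h = L *v b' + k" for b b' f g h k
  proof -
    let ?s = "b + f + g - h - k"
    have "real_vec b' = ?I *v (real_mat L *v real_vec b')"
      using expansion unfolding expansion_matrix_def by (simp add: matrix_inv_mult_vec)
    also have "real_mat L *v real_vec b' = real_vec ?s"
      using eq by (simp add: real_vec_mult[symmetric])
    finally have "norm (real_vec b') \<le> c * norm (real_vec ?s)"
      unfolding c_def using onorm[OF matrix_vector_mul_bounded_linear[of ?I]] by metis
    also have "norm (real_vec ?s) \<le>
        norm (real_vec b) + norm (real_vec f) + norm (real_vec g) + norm (real_vec h) + norm (real_vec k)"
      unfolding real_vec_add real_vec_diff
      by (intro norm_triangle_le_diff norm_triangle_le add_mono order_refl)
    also have "\<dots> \<le> K + 4 * r"
      using b r(2)[OF F(1)] r(2)[OF F(2)] r(2)[OF F(3)] r(2)[OF F(4)] by linarith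
    finally show ?thesis using K c by (simp add: mult_left_mono)
  qed
  have "\<exists>b. norm (real_vec b) \<le> K \<and> (\<exists>k\<in>supp L F n. f + g - h = E n b + k)"
    if "f \<in> supp L F n" "g \<in> supp L F n" "h \<in> supp L F n" for n f g h
    using that
  proof (induction n arbitrary: f g h)
    case 0
    then show ?case using K(1) by (intro exI[of _ 0]) (simp add: real_vec_0)
  next
    case (Suc n)
    obtain f0 f1 where f: "f0 \<in> supp L F n" "f1 \<in> F" "f = f0 + E n f1"
      using Suc.prems(1) unfolding supp_Suc_outer by blast
    obtain g0 g1 where g: "g0 \<in> supp L F n" "g1 \<in> F" "g = g0 + E n g1"
      using Suc.prems(2) unfolding supp_Suc_outer by blast
    obtain h0 h1 where h: "h0 \<in> supp L F n" "h1 \<in> F" "h = h0 + E n h1"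
      using Suc.prems(3) unfolding supp_Suc_outer by blast
    obtain b k where b: "norm (real_vec b) \<le> K" "k \<in> supp L F n" "f0 + g0 - h0 = E n b + k"
      using Suc.IH[OF f(1) g(1) h(1)] by blast
    \<comment> \<open>The carry b out of the n lower digits joins the top digits; the quotient b' is
      the new carry and k' the top digit of the result.\<close>
    obtain b' k' where k': "k' \<in> F" "b + f1 + g1 - h1 = L *v b' + k'"
      by (rule F_split)
    have "f + g - h = (f0 + g0 - h0) + E n (f1 + g1 - h1)"
      by (simp add: f g h E_add E_diff)
    also have "\<dots> = k + E n (b + f1 + g1 - h1)"
      by (simp add: b E_add E_diff)
    also have "\<dots> = E (Suc n) b' + (k + E n k')"
      by (simp add: k' E_add funpow_swap1)
    finally show ?case
      using step[OF b(1) f(2) g(2) h(2) k'] b(2) k'(1) supp_Suc_outer by blast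
  qed
  then show ?thesis
    using finite_bounded_int_vecs[of K] K(1)
    by (intro that[of "{b. norm (real_vec b) \<le> K}"]) (auto simp: real_vec_0)
qed

text \<open>A pattern of x occurs in some \<zeta>^n(e), and by primitivity the letter e occurs in
  \<zeta>^m of every letter, so the pattern appears in every block of level n + m. There are only
  finitely many patterns of shape P, hence one Q serves all of them.\<close>

lemma uniformly_recurrent:
  assumes P: "finite P"
  obtains Q where "finite Q" "\<And>j a. \<exists>c\<in>Q. \<forall>b\<in>P. x (a + c + b) = x (j + b)"
proof -
  obtain m where m: "\<And>a b. \<exists>k\<in>supp L F m. iterate L F \<zeta> m a k = b"
    using prim unfolding primitive_def by blast
  \<comment> \<open>Restricting to P identifies positions that carry the same pattern, which makes U
    finite.\<close>
  define U where "U = (\<lambda>j. restrict (\<lambda>b. x (j + b)) P) ` UNIV"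
  have "U \<subseteq> (\<Pi>\<^sub>E b\<in>P. UNIV)" unfolding U_def by auto
  then have "finite U" by (rule finite_subset) (simp add: finite_PiE P)
  have "\<exists>Q. finite Q \<and> (\<forall>a. \<exists>c\<in>Q. \<forall>b\<in>P. x (a + c + b) = u b)" if "u \<in> U" for u
  proof -
    obtain j where "u = restrict (\<lambda>b. x (j + b)) P"
      using \<open>u \<in> U\<close> unfolding U_def by blast
    then have j: "u b = x (j + b)" if "b \<in> P" for b
      using that by simp
    have "occurs P u UNIV x"
      unfolding occurs_def by (intro exI[of _ j]) (simp add: j)
    then obtain n e where "occurs P u (supp L F n) (iterate L F \<zeta> n e)"
      using x_in P unfolding subst_shift_def by blast
    then obtain q where q: "\<And>b. b \<in> P \<Longrightarrow> q + b \<in> supp L F n"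
        "\<And>b. b \<in> P \<Longrightarrow> iterate L F \<zeta> n e (q + b) = u b"
      unfolding occurs_def by blast
    \<comment> \<open>From a, the term - f leads back to the corner of its block of level n + m,
      \<open>E n k\<close> to the subblock \<zeta>^n(e), and q to the occurrence inside it.\<close>
    define Q where "Q = (\<lambda>(k, f). E n k + q - f) ` (supp L F m \<times> supp L F (n + m))"
    have "\<exists>c\<in>Q. \<forall>b\<in>P. x (a + c + b) = u b" for a
    proof -
      obtain i f where f: "f \<in> supp L F (n + m)" "a = E (n + m) i + f"
        using supp_split by blast
      obtain k where k: "k \<in> supp L F m" "iterate L F \<zeta> m (x i) k = e"
        using m by blast
      have "x (a + (E n k + q - f) + b) = u b" if "b \<in> P" for b
      proof -
        have "a + (E n k + q - f) + b = E n (E m i + k) + (q + b)"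
          by (simp add: f(2) E_add funpow_add)
        then have "x (a + (E n k + q - f) + b) = iterate L F \<zeta> n (x (E m i + k)) (q + b)"
          by (simp only: fixed_iterate[OF q(1)[OF that]])
        also have "\<dots> = u b"
          using fixed_iterate[OF k(1)] k(2) q(2)[OF that] by simp
        finally show ?thesis .
      qed
      moreover have "E n k + q - f \<in> Q"
        using k(1) f(1) unfolding Q_def by auto
      ultimately show ?thesis by blast
    qed
    moreover have "finite Q" unfolding Q_def by (simp add: finite_supp)
    ultimately show ?thesis by blast
  qed
  then obtain Q where Q: "\<And>u. u \<in> U \<Longrightarrow> finite (Q u)"
      "\<And>u a. u \<in> U \<Longrightarrow> \<exists>c\<in>Q u. \<forall>b\<in>P. x (a + c + b) = u b"
    by metis
  have "\<exists>c\<in>(\<Union>u\<in>U. Q u). \<forall>b\<in>P. x (a + c + b) = x (j + b)" for j a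
  proof -
    have U: "restrict (\<lambda>b. x (j + b)) P \<in> U" unfolding U_def by blast
    obtain c where "c \<in> Q (restrict (\<lambda>b. x (j + b)) P)" "\<forall>b\<in>P. x (a + c + b) = x (j + b)"
      using Q(2)[OF U, of a] by auto
    with U show ?thesis by blast
  qed
  moreover have "finite (\<Union>u\<in>U. Q u)" using Q(1) \<open>finite U\<close> by auto
  ultimately show ?thesis using that by blast
qed

end

section \<open>Repulsion of local periods in the coded point\<close>

locale aperiodic_coding = substitution_fixed_point L F \<zeta> x
  for L :: "int ^ 'd ^ 'd::finite" and F and \<zeta> :: "'a::finite \<Rightarrow> int ^ 'd \<Rightarrow> 'a" and x +
  fixes \<tau> :: "'a \<Rightarrow> 'b" and y :: "('d, 'b) config"
  assumes y_eq: "y = \<tau> \<circ> x"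
    and no_period: "\<And>p. (\<And>k. y (k + p) = y k) \<Longrightarrow> p = 0"
begin

lemma y_cong_block: "x i = x j \<Longrightarrow> h \<in> supp L F n \<Longrightarrow> y (E n i + h) = y (E n j + h)"
  by (simp add: y_eq fixed_iterate)

text \<open>The point is that \<open>Q\<close> does not depend on \<open>n\<close>: a shift by \<open>g - f\<close> moves a level-\<open>n\<close> block only
  into neighbouring blocks, so whether it is a local period is decided by patterns of \<open>x\<close> of fixed
  size, and all of these occur near \<open>a\<close>.\<close>

lemma repulsion:
  obtains Q where "finite Q"
    "\<And>n a f g. f \<in> supp L F n \<Longrightarrow> g \<in> supp L F n \<Longrightarrow>
      (\<And>b h. b \<in> Q \<Longrightarrow> h \<in> supp L F n \<Longrightarrow>
        y (E n (a + b) + h + (g - f)) = y (E n (a + b) + h)) \<Longrightarrow> f = g"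
proof -
  obtain C where C: "finite C" "0 \<in> C"
    "\<And>n f g h. f \<in> supp L F n \<Longrightarrow> g \<in> supp L F n \<Longrightarrow> h \<in> supp L F n \<Longrightarrow>
      \<exists>b\<in>C. \<exists>k\<in>supp L F n. f + g - h = E n b + k"
    by (rule bounded_carries) blast
  obtain Q where Q: "finite Q" "\<And>j a. \<exists>c\<in>Q. \<forall>b\<in>C. x (a + c + b) = x (j + b)"
    by (rule uniformly_recurrent[OF C(1)]) blast
  have "f = g"
    if fg: "f \<in> supp L F n" "g \<in> supp L F n"
      and per: "\<And>b h. b \<in> Q \<Longrightarrow> h \<in> supp L F n \<Longrightarrow>
        y (E n (a + b) + h + (g - f)) = y (E n (a + b) + h)" for n a f g
  proof -
    have "y (k + (g - f)) = y k" for k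
    proof -
      obtain j h where h: "h \<in> supp L F n" "k = E n j + h" using supp_split by blast
      obtain c where c: "c \<in> Q" "\<And>b. b \<in> C \<Longrightarrow> x (a + c + b) = x (j + b)"
        using Q(2)[of a j] by blast
      \<comment> \<open>The shifted point lies in block j + b, which has a copy at a + c + b. There
        the local period undoes the shift, and the copy of block j itself leads back to k; this last
        move uses 0 in C.\<close>
      obtain b h' where b: "b \<in> C" "h' \<in> supp L F n" "h + g - f = E n b + h'"
        using C(3)[OF h(1) fg(2,1)] by blast
      have h': "h' = h + g - f - E n b" unfolding b(3) by simp
      have "k + (g - f) = E n (j + b) + h'"
        by (simp add: h(2) h' E_add)
      then have "y (k + (g - f)) = y (E n (a + c + b) + h')"
        by (simp only: y_cong_block[OF c(2)[OF b(1)] b(2)])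
      also have "E n (a + c + b) + h' = E n (a + c) + h + (g - f)"
        by (simp add: h' E_add)
      also have "y (\<dots>) = y (E n (a + c) + h)" by (rule per[OF c(1) h(1)])
      also have "\<dots> = y k"
        using y_cong_block[OF c(2)[OF C(2)] h(1)] unfolding h(2) add_0_right .
      finally show ?thesis .
    qed
    then have "g - f = 0" by (rule no_period)
    then show ?thesis by simp
  qed
  then show ?thesis by (rule that[OF Q(1)])
qed

section \<open>Return classes modulo L^n and their torsion\<close>

definition returns :: "nat \<Rightarrow> (int ^ 'd) set" where
  "returns n = {g. \<forall>P. finite P \<longrightarrow> (\<exists>i. i - g \<in> \<Lambda> n \<and> (\<forall>b\<in>P. y (i + b) = y b))}"

lemma returnsD:
  "g \<in> returns n \<Longrightarrow> finite P \<Longrightarrow> \<exists>i. i - g \<in> \<Lambda> n \<and> (\<forall>b\<in>P. y (i + b) = y b)"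
  by (simp add: returns_def)

lemma returns_0: "0 \<in> returns n"
proof -
  have "0 - 0 \<in> \<Lambda> n" by (rule range_eqI[of _ _ 0]) (use E_diff[of n 0 0] in simp)
  then have "\<exists>i. i - 0 \<in> \<Lambda> n \<and> (\<forall>b\<in>P. y (i + b) = y b)" for P
    by (intro exI[of _ 0]) simp
  then show ?thesis unfolding returns_def by blast
qed

text \<open>The second return is taken for the window translated by i: the pattern at i + P is then
  copied to i + j + P, and it is already the central one.\<close>

lemma returns_add:
  assumes g: "g \<in> returns n" and h: "h \<in> returns n"
  shows "g + h \<in> returns n"
  unfolding returns_def
proof clarify
  fix P :: "(int ^ 'd) set" assume P: "finite P"
  obtain i where i: "i - g \<in> \<Lambda> n" "\<forall>b\<in>P. y (i + b) = y b"
    using returnsD[OF g P] by blast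
  obtain j where j: "j - h \<in> \<Lambda> n" "\<forall>b\<in>(+) i ` P. y (j + b) = y b"
    using returnsD[OF h finite_imageI[OF P]] by blast
  have "i + j - (g + h) = (i - g) + (j - h)" by simp
  then have "i + j - (g + h) \<in> \<Lambda> n" using \<Lambda>_add i(1) j(1) by presburger
  moreover have "y (i + j + b) = y b" if "b \<in> P" for b
    using i(2) j(2) that by (simp add: add.left_commute add.assoc)
  ultimately show "\<exists>i. i - (g + h) \<in> \<Lambda> n \<and> (\<forall>b\<in>P. y (i + b) = y b)" by blast
qed

lemma returns_scale: "g \<in> returns n \<Longrightarrow> of_nat t *s g \<in> returns n"
proof (induction t)
  case 0
  then show ?case using returns_0 by simp
next
  case (Suc t)
  have "of_nat (Suc t) *s g = g + of_nat t *s g"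
    by (simp add: vec_eq_iff algebra_simps)
  with Suc returns_add show ?case by metis
qed

text \<open>Pigeonhole on the N + 1 multiples 0, g, ..., N g, where N counts the maps from Q to the
  alphabet. If the returns for s g and t g lie in blocks \<open>a s\<close> and \<open>a t\<close>
  with equal surroundings in x, then \<open>f t - f s\<close> is a local period, which
  \<open>repulsion\<close> forces to be 0; thus (t - s) g lies in \<Lambda> n. Since Q is
  independent of n, so are N and the multiplier.\<close>

lemma returns_multiple:
  obtains M :: nat where "M > 0" "\<And>n g. g \<in> returns n \<Longrightarrow> of_nat M *s g \<in> \<Lambda> n"
proof -
  obtain Q where Q: "finite Q"
    "\<And>n a f g. f \<in> supp L F n \<Longrightarrow> g \<in> supp L F n \<Longrightarrow>
      (\<And>b h. b \<in> Q \<Longrightarrow> h \<in> supp L F n \<Longrightarrow>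
        y (E n (a + b) + h + (g - f)) = y (E n (a + b) + h)) \<Longrightarrow> f = g"
    by (rule repulsion) blast
  let ?U = "Q \<rightarrow>\<^sub>E (UNIV :: 'a set)"
  have "finite ?U" using Q(1) by (intro finite_PiE) auto
  define N where "N = card ?U"
  have main: "\<exists>t\<in>{1..N}. of_nat t *s g \<in> \<Lambda> n" if g: "g \<in> returns n" for n g
  proof -
    \<comment> \<open>For w = E n b + h - f s, the return for s turns w into a point of a block near
      \<open>a s\<close>, and the return for t into the corresponding point near \<open>a t\<close>
      shifted by \<open>f t - f s\<close>. The offset \<open>f s\<close> is chosen only after W, so
      W allows every f.\<close>
    define W where "W = (\<lambda>(b, h, f). E n b + h - f) ` (Q \<times> supp L F n \<times> supp L F n)"
    have "finite W" unfolding W_def using Q(1) finite_supp by simp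
    have "\<exists>a f. f \<in> supp L F n \<and> E n a + f - of_nat t *s g \<in> \<Lambda> n \<and>
        (\<forall>b\<in>W. y (E n a + f + b) = y b)" for t
      using returnsD[OF returns_scale[OF g, of t] \<open>finite W\<close>] supp_split by metis
    then obtain a f where f: "\<And>t. f t \<in> supp L F n"
        and \<Lambda>: "\<And>t. E n (a t) + f t - of_nat t *s g \<in> \<Lambda> n"
        and agree: "\<And>t b. b \<in> W \<Longrightarrow> y (E n (a t) + f t + b) = y b"
      by metis
    define u where "u t = restrict (\<lambda>b. x (a t + b)) Q" for t
    have "\<not> inj_on u {0..N}"
    proof (rule pigeonhole)
      have "card (u ` {0..N}) \<le> N"
        unfolding N_def by (intro card_mono \<open>finite ?U\<close>) (auto simp: u_def)
      then show "card (u ` {0..N}) < card {0..N}" by simp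
    qed
    then obtain s t where st: "s < t" "t \<le> N" "u s = u t"
      unfolding inj_on_def by (metis atLeastAtMost_iff linorder_neqE_nat)
    have x_eq: "x (a s + b) = x (a t + b)" if "b \<in> Q" for b
      using fun_cong[OF st(3), of b] that by (simp add: u_def)
    have "f s = f t"
    proof (rule Q(2)[OF f f])
      fix b h assume b: "b \<in> Q" and h: "h \<in> supp L F n"
      have w: "E n b + h - f s \<in> W"
        unfolding W_def using b h f by force
      have "y (E n (a t + b) + h + (f t - f s)) = y (E n (a t) + f t + (E n b + h - f s))"
        by (simp add: E_add algebra_simps)
      also have "\<dots> = y (E n (a s) + f s + (E n b + h - f s))"
        by (simp only: agree[OF w])
      also have "E n (a s) + f s + (E n b + h - f s) = E n (a s + b) + h" by (simp add: E_add)
      also have "y \<dots> = y (E n (a t + b) + h)" by (rule y_cong_block[OF x_eq[OF b] h])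
      finally show "y (E n (a t + b) + h + (f t - f s)) = y (E n (a t + b) + h)" .
    qed
    moreover have "of_nat (t - s) *s g = of_nat t *s g - of_nat s *s g"
      using st(1) by (simp add: vec_eq_iff of_nat_diff algebra_simps)
    ultimately have "of_nat (t - s) *s g =
        (E n (a s) + f s - of_nat s *s g) - (E n (a t) + f t - of_nat t *s g) + E n (a t - a s)"
      by (simp add: E_diff)
    then have "of_nat (t - s) *s g \<in> \<Lambda> n"
      using \<Lambda>_add[OF \<Lambda>_diff[OF \<Lambda> \<Lambda>]] by simp
    then show ?thesis using st by (intro bexI[of _ "t - s"]) auto
  qed
  \<comment> \<open>The multiple t depends on g and n, but it is at most N and so divides
    N!.\<close>
  have "of_nat (fact N) *s g \<in> \<Lambda> n" if "g \<in> returns n" for n g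
  proof -
    obtain t where t: "t \<in> {1..N}" "of_nat t *s g \<in> \<Lambda> n" using main \<open>g \<in> returns n\<close> by blast
    then have "t dvd fact N" by (simp add: dvd_fact)
    then obtain r where "fact N = r * t" by (metis dvdE mult.commute)
    then have "of_nat (fact N) *s g = of_nat r *s (of_nat t *s g)"
      by (simp add: vec_eq_iff)
    then show ?thesis using \<Lambda>_scale t(2) by metis
  qed
  then show ?thesis using that[of "fact N"] by simp
qed

text \<open>Compactness: a class modulo \<Lambda> n splits into finitely many classes modulo
  \<Lambda> (n + 1). If each failed on a window of its own, a return for the union of these windows
  would lie in one of the failing classes.\<close>

lemma returns_lift:
  assumes g: "g \<in> returns n"
  obtains g' where "g' \<in> returns (Suc n)" "g' - g \<in> \<Lambda> n"
proof (rule ccontr)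
  assume "\<not> thesis"
  with that have "f \<notin> returns (Suc n)" if "f - g \<in> \<Lambda> n" for f
    using \<open>f - g \<in> \<Lambda> n\<close> by blast
  then have "\<exists>P. finite P \<and> (f - g \<in> \<Lambda> n \<longrightarrow>
      \<not> (\<exists>i. i - f \<in> \<Lambda> (Suc n) \<and> (\<forall>b\<in>P. y (i + b) = y b)))" for f
    unfolding returns_def by blast
  then obtain P where P: "\<And>f. finite (P f)" "\<And>f i. f - g \<in> \<Lambda> n \<Longrightarrow> i - f \<in> \<Lambda> (Suc n) \<Longrightarrow>
      (\<forall>b\<in>P f. y (i + b) = y b) \<Longrightarrow> False"
    by metis
  have "finite (\<Union>f\<in>supp L F (Suc n). P f)" using P(1) finite_supp by blast
  from returnsD[OF g this] obtain i where i: "i - g \<in> \<Lambda> n"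
      "\<forall>b\<in>(\<Union>f\<in>supp L F (Suc n). P f). y (i + b) = y b" by blast
  obtain j f where f: "f \<in> supp L F (Suc n)" "i = E (Suc n) j + f" using supp_split by blast
  then have if_: "i - f \<in> \<Lambda> (Suc n)" by simp
  have "f - g = (i - g) - (i - f)" by simp
  then have "f - g \<in> \<Lambda> n" using \<Lambda>_diff[OF i(1) \<Lambda>_Suc[OF if_]] by simp
  then show False using P(2)[OF _ if_] i(2) f(1) by blast
qed

text \<open>Torsion-freeness of the odometer: if \<open>M g\<^sub>n = L\<^sup>n v\<^sub>n\<close> for a coherent sequence, then
  \<open>v\<^sub>n = L v\<^bsub>n+1\<^esub>\<close> modulo \<open>M\<close>, so a repetition \<open>v\<^sub>a = v\<^sub>b\<close> modulo \<open>M\<close> puts \<open>v\<^sub>a\<close> on a cycle of \<open>L\<close>. Since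
  \<open>L\<^sup>a v\<^sub>a = v\<^sub>0 = 0\<close>, that cycle is zero.\<close>

lemma returns_1_subset: "returns 1 \<subseteq> \<Lambda> 1"
proof
  fix g assume g: "g \<in> returns 1"
  obtain M :: nat where M: "M > 0" "\<And>n g. g \<in> returns n \<Longrightarrow> of_nat M *s g \<in> \<Lambda> n"
    by (rule returns_multiple) blast
  have "\<exists>G. \<forall>n. (G n \<in> returns (Suc n) \<and> (n = 0 \<longrightarrow> G n = g)) \<and> G (Suc n) - G n \<in> \<Lambda> (Suc n)"
  proof (rule dependent_nat_choice)
    show "\<exists>h. h \<in> returns (Suc 0) \<and> (0 = 0 \<longrightarrow> h = g)" using g by simp
    show "\<exists>h'. (h' \<in> returns (Suc (Suc n)) \<and> (Suc n = 0 \<longrightarrow> h' = g)) \<and> h' - h \<in> \<Lambda> (Suc n)"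
      if "h \<in> returns (Suc n) \<and> (n = 0 \<longrightarrow> h = g)" for h n
    proof -
      from that have "h \<in> returns (Suc n)" by simp
      then obtain h' where "h' \<in> returns (Suc (Suc n))" "h' - h \<in> \<Lambda> (Suc n)"
        by (rule returns_lift)
      then show ?thesis by blast
    qed
  qed
  then obtain G where G: "G 0 = g" "\<And>n. G n \<in> returns (Suc n)"
      "\<And>n. G (Suc n) - G n \<in> \<Lambda> (Suc n)"
    by blast
  \<comment> \<open>The extra entry 0 at level 0 aligns the index with the level and yields v 0 =
    0.\<close>
  define H where "H n = (case n of 0 \<Rightarrow> 0 | Suc n \<Rightarrow> G n)" for n
  have H: "H n \<in> returns n" "H (Suc n) - H n \<in> \<Lambda> n" for n
    using G returns_0 by (auto simp: H_def split: nat.split)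
  obtain v where v: "\<And>n. of_nat M *s H n = E n (v n)"
    using M(2)[OF H(1)] unfolding image_iff by metis
  obtain w where w: "\<And>n. H (Suc n) - H n = E n (w n)"
    using H(2) unfolding image_iff by metis
  have v_step: "v n = L *v v (Suc n) - of_nat M *s w n" for n
  proof (rule inj_E)
    have "E n (v n) = of_nat M *s H (Suc n) - of_nat M *s (H (Suc n) - H n)"
      by (simp only: v flip: vector_ssub_ldistrib) (simp add: v)
    also have "\<dots> = E n (L *v v (Suc n)) - of_nat M *s E n (w n)"
      by (simp only: v w) (simp add: funpow_swap1)
    finally show "E n (v n) = E n (L *v v (Suc n) - of_nat M *s w n)"
      by (simp add: E_diff E_scale)
  qed
  define zero where "zero u \<longleftrightarrow> (\<exists>t. u = of_nat M *s t)" for u :: "int ^ 'd"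
  have zero_diff: "zero (t - u)" if "zero t" "zero u" for t u
    using that unfolding zero_def by (metis vector_ssub_ldistrib)
  have zero_add: "zero (t + u)" if "zero t" "zero u" for t u
    using that unfolding zero_def by (metis vector_add_ldistrib)
  have zero_E: "zero (E n u)" if "zero u" for n u
    using that E_scale unfolding zero_def by metis
  have v_steps: "zero (E k (v (n + k)) - v n)" for n k
  proof (induction k)
    case 0
    show ?case unfolding zero_def by (auto intro: exI[of _ 0])
  next
    case (Suc k)
    have "E (Suc k) (v (n + Suc k)) - v n = E k (of_nat M *s w (n + k)) + (E k (v (n + k)) - v n)"
      by (subst v_step[of "n + k"]) (simp add: E_diff funpow_swap1)
    moreover have "zero (of_nat M *s w (n + k))" unfolding zero_def by blast
    ultimately show ?case using zero_add zero_E Suc by metis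
  qed
  \<comment> \<open>Residue vectors modulo M are finite in number, so two of v 1, v 2, ... agree.
    Having a > 0 permits the final descent from v a to v 1.\<close>
  have "\<exists>a b. 0 < a \<and> a < b \<and> zero (v a - v b)"
  proof -
    let ?r = "\<lambda>n. \<chi> i. v n $ i mod int M"
    have r: "\<bar>real_of_int (v n $ i mod int M)\<bar> \<le> real M" for n i
    proof -
      have "0 \<le> v n $ i mod int M" "v n $ i mod int M < int M" using M(1) by simp_all
      then show ?thesis by linarith
    qed
    have "range ?r \<subseteq> {u. norm (real_vec u) \<le> norm ((\<chi> i. real M) :: real ^ 'd)}"
      by (auto intro!: norm_le_componentwise_cart simp: real_vec_def r)
    then have "finite (?r ` {1..})"
      using finite_subset finite_bounded_int_vecs by (metis image_mono subset_UNIV)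
    then have "\<not> inj_on ?r {1..}"
      using infinite_Ici finite_image_iff by blast
    then obtain a b where ab: "0 < a" "a < b" "?r a = ?r b"
      unfolding inj_on_def by (metis atLeast_iff linorder_neqE_nat less_eq_Suc_le One_nat_def)
    have "int M dvd v a $ i - v b $ i" for i
      using ab(3) by (simp add: vec_eq_iff mod_eq_dvd_iff)
    then obtain t where "\<And>i. v a $ i - v b $ i = int M * t i" unfolding dvd_def by metis
    then have "v a - v b = of_nat M *s (\<chi> i. t i)" by (simp add: vec_eq_iff)
    then show ?thesis using ab unfolding zero_def by blast
  qed
  then obtain a b where ab: "0 < a" "a < b" "zero (v a - v b)" by blast
  define p where "p = b - a"
  have p: "a + p = b" "p > 0" using ab(2) by (simp_all add: p_def)
  have "E p (v a) - v a = E p (v a - v b) + (E p (v (a + p)) - v a)"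
    by (simp add: p E_diff)
  then have period: "zero (E p (v a) - v a)"
    using zero_add zero_E ab(3) v_steps by metis
  have cycle: "zero (E (k * p) (v a) - v a)" for k
  proof (induction k)
    case 0
    show ?case unfolding zero_def by (auto intro: exI[of _ 0])
  next
    case (Suc k)
    have "E (Suc k * p) (v a) = E (k * p) (E p (v a))"
      by (simp add: add.commute[of p] funpow_add)
    then have "E (Suc k * p) (v a) - v a = E (k * p) (E p (v a) - v a) + (E (k * p) (v a) - v a)"
      by (simp add: E_diff)
    then show ?case
      using zero_add zero_E period Suc by metis
  qed
  have "v 0 = 0" using v[of 0] by (simp add: H_def)
  then have "zero (E a (v a))" using v_steps[where n = 0 and k = a] by simp
  \<comment> \<open>Going round the cycle a times gives a * p \<ge> a applications of L, enough to
    pass through L^a (v a), which vanishes modulo M.\<close>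
  moreover have "E (a * p) (v a) = E (a * p - a) (E a (v a))"
    using p(2) by (simp flip: funpow_add comp_apply[of "E (a * p - a)" "E a"])
  ultimately have "zero (E (a * p) (v a))"
    using zero_E by simp
  then have "zero (v a)"
    using zero_diff[OF _ cycle[of a]] by force
  then have "zero (v 1)"
    using zero_diff[OF zero_E[of "v a" "a - 1"] v_steps[where n = 1 and k = "a - 1"]] ab(1) by simp
  then obtain t where "v 1 = of_nat M *s t" unfolding zero_def by blast
  then have "of_nat M *s g = of_nat M *s E 1 t"
    using v[of 1] G(1) by (simp add: H_def E_scale[of 1, simplified])
  then have "g = E 1 t" using M(1) by (simp add: vec_eq_iff)
  then show "g \<in> \<Lambda> 1" by blast
qed

section \<open>From return classes to recognizability\<close>

lemma uniformly_recurrent_lattice: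
  assumes P: "finite P"
  obtains Q where "finite Q" "\<And>a. \<exists>c\<in>Q. a + c \<in> \<Lambda> n \<and> (\<forall>b\<in>P. y (a + c + b) = y b)"
proof -
  have "\<exists>i. \<exists>h\<in>supp L F n. b = E n i + h" for b using supp_split by blast
  then obtain i h where h: "\<And>b. h b \<in> supp L F n" "\<And>b. b = E n (i b) + h b" by metis
  obtain Q where Q: "finite Q" "\<And>j a. \<exists>c\<in>Q. \<forall>b\<in>i ` P. x (a + c + b) = x (j + b)"
    by (rule uniformly_recurrent[OF finite_imageI[OF P]]) blast
  define Q' where "Q' = (\<lambda>(c, f). E n c - f) ` (Q \<times> supp L F n)"
  have "\<exists>c\<in>Q'. a + c \<in> \<Lambda> n \<and> (\<forall>b\<in>P. y (a + c + b) = y b)" for a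
  proof -
    obtain j f where f: "f \<in> supp L F n" "a = E n j + f" using supp_split by blast
    obtain c where c: "c \<in> Q" "\<And>b. b \<in> P \<Longrightarrow> x (j + c + i b) = x (0 + i b)"
      using Q(2)[of j 0] by blast
    have eq: "a + (E n c - f) = E n (j + c)" by (simp add: f E_add)
    have "y (E n (j + c) + b) = y b" if "b \<in> P" for b
    proof -
      have "y (E n (j + c) + b) = y (E n (j + c + i b) + h b)"
        by (subst h(2)[of b]) (simp add: E_add add.assoc)
      also have "\<dots> = y (E n (i b) + h b)"
        using y_cong_block[OF c(2)[OF that] h(1)] by simp
      finally show ?thesis using h(2)[of b] by simp
    qed
    moreover have "E n c - f \<in> Q'" using c(1) f(1) unfolding Q'_def by force
    ultimately show ?thesis using eq by (intro bexI[of _ "E n c - f"]) auto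
  qed
  moreover have "finite Q'" unfolding Q'_def using Q(1) finite_supp by simp
  ultimately show ?thesis using that by blast
qed

text \<open>For a class f outside \<Lambda> 1, some window P never returns in f + \<Lambda> 1. From
  i in \<Lambda> 1 a bounded step c reaches a lattice return of that window; if y looks alike around
  i and j, then j + c is a return too, so j is not in f + \<Lambda> 1. Finitely many f cover all
  classes.\<close>

lemma recognizable:
  obtains P where "finite P"
    "\<And>i j. (\<And>b. b \<in> P \<Longrightarrow> y (i + b) = y (j + b)) \<Longrightarrow> i \<in> \<Lambda> 1 \<Longrightarrow> j \<in> \<Lambda> 1"
proof -
  have "\<exists>P. finite P \<and> (\<forall>i j. (\<forall>b\<in>P. y (i + b) = y (j + b)) \<longrightarrow> i \<in> \<Lambda> 1 \<longrightarrow> j - f \<in> \<Lambda> 1 \<longrightarrow> f \<in> \<Lambda> 1)" for f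
  proof (cases "f \<in> \<Lambda> 1")
    case False
    then have "f \<notin> returns 1" using returns_1_subset by blast
    then obtain P where P: "finite P" "\<And>i. i - f \<in> \<Lambda> 1 \<Longrightarrow> \<exists>b\<in>P. y (i + b) \<noteq> y b"
      unfolding returns_def mem_Collect_eq by blast
    obtain Q where Q: "finite Q" "\<And>a. \<exists>c\<in>Q. a + c \<in> \<Lambda> 1 \<and> (\<forall>b\<in>P. y (a + c + b) = y b)"
      by (rule uniformly_recurrent_lattice[OF P(1), where n = 1]) blast
    define P' where "P' = (\<lambda>(c, b). c + b) ` (Q \<times> P)"
    have False if eq: "\<forall>b\<in>P'. y (i + b) = y (j + b)" and i: "i \<in> \<Lambda> 1" and j: "j - f \<in> \<Lambda> 1" for i j
    proof -
      obtain c where c: "c \<in> Q" "i + c \<in> \<Lambda> 1" "\<forall>b\<in>P. y (i + c + b) = y b"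
        using Q(2)[of i] by blast
      have "j + c - f = (j - f) + ((i + c) - i)" by simp
      then have "j + c - f \<in> \<Lambda> 1" using \<Lambda>_add[OF j \<Lambda>_diff[OF c(2) i]] by (simp only:)
      then obtain b where b: "b \<in> P" "y (j + c + b) \<noteq> y b" using P(2) by blast
      then have "c + b \<in> P'" using c(1) unfolding P'_def by auto
      then have "y (i + c + b) = y (j + c + b)" using eq by (simp add: add.assoc)
      then show False using c(3) b by simp
    qed
    moreover have "finite P'" unfolding P'_def using P(1) Q(1) by simp
    ultimately show ?thesis by blast
  qed auto
  then obtain P where P: "\<And>f. finite (P f)"
      "\<And>f i j. (\<forall>b\<in>P f. y (i + b) = y (j + b)) \<Longrightarrow> i \<in> \<Lambda> 1 \<Longrightarrow> j - f \<in> \<Lambda> 1 \<Longrightarrow> f \<in> \<Lambda> 1"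
    by metis
  show ?thesis
  proof (rule that)
    show "finite (\<Union>f\<in>supp L F 1. P f)" using P(1) finite_supp by blast
    fix i j assume eq: "\<And>b. b \<in> (\<Union>f\<in>supp L F 1. P f) \<Longrightarrow> y (i + b) = y (j + b)" and i: "i \<in> \<Lambda> 1"
    obtain k f where f: "f \<in> supp L F 1" "j = E 1 k + f" using supp_split by blast
    then have jf: "j - f \<in> \<Lambda> 1" by simp
    have "\<forall>b\<in>P f. y (i + b) = y (j + b)" using eq f(1) by blast
    then have "f \<in> \<Lambda> 1" by (rule P(2)[OF _ i jf])
    from \<Lambda>_add[OF jf this] show "j \<in> \<Lambda> 1" by (simp only: diff_add_cancel)
  qed
qed

end

theorem proposition3p7:
  fixes L :: "int ^ 'd ^ 'd::finite"
    and F :: "(int ^ 'd) set"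
    and \<zeta> :: "'a::finite \<Rightarrow> int ^ 'd \<Rightarrow> 'a"
    and \<tau> :: "'a \<Rightarrow> 'b::finite"
    and x :: "('d, 'a) config"
    and y :: "('d, 'b) config"
  assumes "substitution_data L F"
    and "primitive L F \<zeta>"
    and "aperiodic (subst_shift L F \<zeta>)"
    and "subshift ((\<lambda>z. \<tau> \<circ> z) ` subst_shift L F \<zeta>)"
    and "aperiodic ((\<lambda>z. \<tau> \<circ> z) ` subst_shift L F \<zeta>)"
    and "x \<in> subst_shift L F \<zeta>"
    and "extend L F \<zeta> x = x"
    and "y = \<tau> \<circ> x"
  shows "\<exists>R>0. \<forall>i j.
           (\<forall>m. real_vec m \<in> ball 0 R \<longrightarrow> y (i + m) = y (j + m)) \<longrightarrow>
           i \<in> lattice L \<longrightarrow> j \<in> lattice L"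
proof -
  interpret aperiodic_coding L F \<zeta> x \<tau> y
  proof unfold_locales
    show "expansion_matrix L" "representatives L F"
      using assms(1) unfolding substitution_data_def by auto
    show "p = 0" if "\<And>k. y (k + p) = y k" for p
      using assms(5,6,8) that unfolding aperiodic_def by blast
  qed (use assms in auto)
  have \<Lambda>_1: "\<Lambda> 1 = lattice L" by (simp add: lattice_def)
  obtain P where P: "finite P"
    "\<And>i j. (\<And>b. b \<in> P \<Longrightarrow> y (i + b) = y (j + b)) \<Longrightarrow> i \<in> \<Lambda> 1 \<Longrightarrow> j \<in> \<Lambda> 1"
    by (rule recognizable) blast
  obtain R where R: "R > 0" "real_vec ` P \<subseteq> ball 0 R"
    using bounded_subset_ballD[OF finite_imp_bounded[OF finite_imageI[OF P(1)]]] by blast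
  show ?thesis
    using P(2) R unfolding \<Lambda>_1 by (intro exI[of _ R]) blast
qed

end
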